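(* The logic $\mathsf{BCL}{-}\mathsf{DC}$ is sound and complete relative to the class of classifier models: for every $\varphi\in\mathcal{L}^{\mathit{dyn}}(\mathit{Atm})$, $\varphi$ is a theorem of $\mathsf{BCL}{-}\mathsf{DC}$ if and only if $(C,s)\models\varphi$ for every classifier model $C=(S,f)$ and every $s\in S$.
   Context: $\mathit{Atm}$ is a finite set of atomic propositions containing the decision atoms $\mathit{Dec}=\{\mathsf{t}(x):x\in\mathit{Val}\}$, $\mathit{Val}$ a finite set. The language $\mathcal{L}^{\mathit{dyn}}(\mathit{Atm})$ is $\varphi::=p\mid\neg\varphi\mid\varphi\wedge\varphi\mid[X]\varphi\mid[x:=\varphi]\psi$ with $p\in\mathit{Atm}$, $X\subseteq\mathit{Atm}$, $x\in\mathit{Val}$; $\langle X\rangle\varphi:=\neg[X]\neg\varphi$. A classifier model is $C=(S,f)$, $S=2^{\mathit{Atm}\setminus\mathit{Dec}}$, $f:S\to\mathit{Val}$; at $(C,s)$: $p\in\mathit{Atm}\setminus\mathit{Dec}$ true iff $p\in s$; $\mathsf{t}(x)$ true iff $f(s)=x$; Boolean clauses as usual; $[X]\varphi$ true iff $\varphi$ true at all $s'\in S$ with $s\cap X=s'\cap X$; $(C,s)\models[x:=\varphi]\psi$ iff $(C^{x:=\varphi},s)\models\psi$, where $C^{x:=\varphi}=(S,f')$ with $f'(s')=x$ if $(C,s')\models\varphi$ and $f'(s')=f(s')$ otherwise. Let $\mathrm{cn}(Y,X)=\bigwedge_{p\in Y}p\wedge\bigwedge_{p\in X\setminus Y}\neg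 p$. $\mathsf{BCL}$ is classical propositional logic plus: $([\emptyset]\varphi\wedge[\emptyset](\varphi\to\psi))\to[\emptyset]\psi$; $[\emptyset]\varphi\to\varphi$; $[\emptyset]\varphi\to[\emptyset][\emptyset]\varphi$; $\varphi\to[\emptyset]\langle\emptyset\rangle\varphi$; $[X]\varphi\leftrightarrow\bigwedge_{Y\subseteq X}(\mathrm{cn}(Y,X)\to[\emptyset](\mathrm{cn}(Y,X)\to\varphi))$; $\bigvee_{x\in\mathit{Val}}\mathsf{t}(x)$; $\mathsf{t}(x)\to\neg\mathsf{t}(y)$ for $x\neq y$; for each $x\in\mathit{Val}$, $\bigwedge_{Y\subseteq\mathit{Atm}\setminus\mathit{Dec}}((\mathrm{cn}(Y,\mathit{Atm}\setminus\mathit{Dec})\wedge\mathsf{t}(x))\to[\emptyset](\mathrm{cn}(Y,\mathit{Atm}\setminus\mathit{Dec})\to\mathsf{t}(x)))$; $\bigwedge_{Y\subseteq\mathit{Atm}\setminus\mathit{Dec}}\langle\emptyset\rangle\mathrm{cn}(Y,\mathit{Atm}\setminus\mathit{Dec})$; modus ponens; and necessitation for $[\emptyset]$. $\mathsf{BCL}{-}\mathsf{DC}$ extends $\mathsf{BCL}$ (over $\mathcal{L}^{\mathit{dyn}}$) with the axioms: $[x:=\varphi]\mathsf{t}(x)\leftrightarrow(\varphi\vee\mathsf{t}(x))$; $[x:=\varphi]\mathsf{t}(y)\leftrightarrow(\neg\varphi\wedge\mathsf{t}(y))$ for $x\neq y$; $[x:=\varphi]p\leftrightarrow p$ for $p\notin\mathit{Dec}$;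 $[x:=\varphi]\neg\psi\leftrightarrow\neg[x:=\varphi]\psi$; $[x:=\varphi](\psi_1\wedge\psi_2)\leftrightarrow([x:=\varphi]\psi_1\wedge[x:=\varphi]\psi_2)$; $[x:=\varphi][X]\psi\leftrightarrow[X][x:=\varphi]\psi$; and the rule of replacement of equivalents: from $\varphi_1\leftrightarrow\varphi_2$ infer $\psi\leftrightarrow\psi'$, where $\psi'$ results from $\psi$ by replacing occurrences of $\varphi_1$ with $\varphi_2$.
   Formalization: The reduction axiom for [X] uses cn(Y, X∖Dec) with Y ⊆ X∖Dec, as it is unsound when X contains decision atoms (e.g. X={t(x)}, φ=t(x)); the result is proved both for all X ⊆ Atm with this axiom and for X ⊆ Atm∖Dec, where the axiom is as stated. *)

theory Defs
  imports Main
begin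

datatype ('a, 'v) fm =
    Atom 'a
  | Neg "('a, 'v) fm" (\<open>\<^bold>\<not> _\<close> [70] 70)
  | Con "('a, 'v) fm" "('a, 'v) fm" (infixr \<open>\<^bold>\<and>\<close> 65)
  | Box "'a set" "('a, 'v) fm"
  | Assign 'v "('a, 'v) fm" "('a, 'v) fm"  \<comment> \<open>\<open>Assign x \<phi> \<psi>\<close> is \<open>[x := \<phi>]\<psi>\<close>\<close>

definition Dis :: "('a, 'v) fm \<Rightarrow> ('a, 'v) fm \<Rightarrow> ('a, 'v) fm" (infixr \<open>\<^bold>\<or>\<close> 60)
  where "\<phi> \<^bold>\<or> \<psi> = \<^bold>\<not> (\<^bold>\<not> \<phi> \<^bold>\<and> \<^bold>\<not> \<psi>)"

definition Imp :: "('a, 'v) fm \<Rightarrow> ('a, 'v) fm \<Rightarrow> ('a, 'v) fm" (infixr \<open>\<^bold>\<longrightarrow>\<close> 55)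
  where "\<phi> \<^bold>\<longrightarrow> \<psi> = \<^bold>\<not> (\<phi> \<^bold>\<and> \<^bold>\<not> \<psi>)"

definition Iff :: "('a, 'v) fm \<Rightarrow> ('a, 'v) fm \<Rightarrow> ('a, 'v) fm" (infix \<open>\<^bold>\<longleftrightarrow>\<close> 50)
  where "\<phi> \<^bold>\<longleftrightarrow> \<psi> = (\<phi> \<^bold>\<longrightarrow> \<psi>) \<^bold>\<and> (\<psi> \<^bold>\<longrightarrow> \<phi>)"

definition Dia :: "'a set \<Rightarrow> ('a, 'v) fm \<Rightarrow> ('a, 'v) fm"
  where "Dia X \<phi> = \<^bold>\<not> Box X (\<^bold>\<not> \<phi>)"

text \<open>
  Truth-functional evaluation: \<open>v\<close> assigns arbitrary truth values to all formulas whose outermost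
  operator is not Boolean. A tautology is thus any substitution instance of a propositional one.
\<close>

primrec truth_value :: "(('a, 'v) fm \<Rightarrow> bool) \<Rightarrow> ('a, 'v) fm \<Rightarrow> bool" where
  "truth_value v (Atom p) = v (Atom p)"
| "truth_value v (\<^bold>\<not> \<phi>) = (\<not> truth_value v \<phi>)"
| "truth_value v (\<phi> \<^bold>\<and> \<psi>) = (truth_value v \<phi> \<and> truth_value v \<psi>)"
| "truth_value v (Box X \<phi>) = v (Box X \<phi>)"
| "truth_value v (Assign x \<phi> \<psi>) = v (Assign x \<phi> \<psi>)"

definition tautology :: "('a, 'v) fm \<Rightarrow> bool"
  where "tautology \<phi> \<longleftrightarrow> (\<forall>v. truth_value v \<phi>)"

text \<open>
  \<open>replaces \<phi>\<^sub>1 \<phi>\<^sub>2 \<psi> \<psi>'\<close>: the formula \<open>\<psi>'\<close> results from \<open>\<psi>\<close> by replacing some (possibly none,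
  possibly all) occurrences of \<open>\<phi>\<^sub>1\<close> as a subformula by \<open>\<phi>\<^sub>2\<close>.
\<close>

inductive replaces ::
    "('a, 'v) fm \<Rightarrow> ('a, 'v) fm \<Rightarrow> ('a, 'v) fm \<Rightarrow> ('a, 'v) fm \<Rightarrow> bool"
  for \<phi>\<^sub>1 \<phi>\<^sub>2 where
  keep: "replaces \<phi>\<^sub>1 \<phi>\<^sub>2 \<psi> \<psi>"
| here: "replaces \<phi>\<^sub>1 \<phi>\<^sub>2 \<phi>\<^sub>1 \<phi>\<^sub>2"
| neg: "replaces \<phi>\<^sub>1 \<phi>\<^sub>2 \<psi> \<psi>' \<Longrightarrow> replaces \<phi>\<^sub>1 \<phi>\<^sub>2 (\<^bold>\<not> \<psi>) (\<^bold>\<not> \<psi>')"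
| con: "replaces \<phi>\<^sub>1 \<phi>\<^sub>2 \<psi> \<psi>' \<Longrightarrow> replaces \<phi>\<^sub>1 \<phi>\<^sub>2 \<chi> \<chi>'
    \<Longrightarrow> replaces \<phi>\<^sub>1 \<phi>\<^sub>2 (\<psi> \<^bold>\<and> \<chi>) (\<psi>' \<^bold>\<and> \<chi>')"
| box: "replaces \<phi>\<^sub>1 \<phi>\<^sub>2 \<psi> \<psi>' \<Longrightarrow> replaces \<phi>\<^sub>1 \<phi>\<^sub>2 (Box X \<psi>) (Box X \<psi>')"
| assign: "replaces \<phi>\<^sub>1 \<phi>\<^sub>2 \<psi> \<psi>' \<Longrightarrow> replaces \<phi>\<^sub>1 \<phi>\<^sub>2 \<chi> \<chi>'
    \<Longrightarrow> replaces \<phi>\<^sub>1 \<phi>\<^sub>2 (Assign x \<psi> \<chi>) (Assign x \<psi>' \<chi>')"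

text \<open>
  \<open>Idx\<close> is the set from whose subsets the indices \<open>X\<close> of \<open>[X]\<close> are taken; the intended values are
  \<open>Atm\<close> and \<open>Atm - Dec\<close>.
\<close>

locale classifier_logic =
  fixes Atm :: "'a set" and Val :: "'v set" and t :: "'v \<Rightarrow> 'a" and Idx :: "'a set"
begin

definition Dec :: "'a set"
  where "Dec = t ` Val"

primrec in_lang :: "('a, 'v) fm \<Rightarrow> bool" where
  "in_lang (Atom p) \<longleftrightarrow> p \<in> Atm"
| "in_lang (\<^bold>\<not> \<phi>) \<longleftrightarrow> in_lang \<phi>"
| "in_lang (\<phi> \<^bold>\<and> \<psi>) \<longleftrightarrow> in_lang \<phi> \<and> in_lang \<psi>"
| "in_lang (Box X \<phi>) \<longleftrightarrow> X \<subseteq> Idx \<and> in_lang \<phi>"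
| "in_lang (Assign x \<phi> \<psi>) \<longleftrightarrow> x \<in> Val \<and> in_lang \<phi> \<and> in_lang \<psi>"

definition lang :: "('a, 'v) fm set"
  where "lang = {\<phi>. in_lang \<phi>}"

definition classifier_model :: "'a set set \<Rightarrow> ('a set \<Rightarrow> 'v) \<Rightarrow> bool"
  where "classifier_model S f \<longleftrightarrow> S = Pow (Atm - Dec) \<and> f ` S \<subseteq> Val"

primrec sat :: "'a set set \<Rightarrow> ('a set \<Rightarrow> 'v) \<Rightarrow> 'a set \<Rightarrow> ('a, 'v) fm \<Rightarrow> bool" where
  "sat S f s (Atom p) \<longleftrightarrow> (if p \<in> Dec then \<exists>x\<in>Val. p = t x \<and> f s = x else p \<in> s)"
| "sat S f s (\<^bold>\<not> \<phi>) \<longleftrightarrow> \<not> sat S f s \<phi>"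
| "sat S f s (\<phi> \<^bold>\<and> \<psi>) \<longleftrightarrow> sat S f s \<phi> \<and> sat S f s \<psi>"
| "sat S f s (Box X \<phi>) \<longleftrightarrow> (\<forall>s'\<in>S. s \<inter> X = s' \<inter> X \<longrightarrow> sat S f s' \<phi>)"
| "sat S f s (Assign x \<phi> \<psi>) \<longleftrightarrow> sat S (\<lambda>s'. if sat S f s' \<phi> then x else f s') s \<psi>"

text \<open>
  The language has no constant for truth, so the empty conjunction is an arbitrary tautology
  \<open>\<not> (p \<and> \<not> p)\<close>. Without atoms the language is empty and \<open>Top\<close> is irrelevant. Finite conjunctions
  and disjunctions are taken in an arbitrary order.
\<close>

definition Top :: "('a, 'v) fm"
  where "Top = (let p = Atom (SOME p. p \<in> Atm) in \<^bold>\<not> (p \<^bold>\<and> \<^bold>\<not> p))"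

definition BigCon :: "('a, 'v) fm set \<Rightarrow> ('a, 'v) fm"
  where "BigCon A = foldr Con (SOME l. distinct l \<and> set l = A) Top"

definition BigDis :: "('a, 'v) fm set \<Rightarrow> ('a, 'v) fm"
  where "BigDis A = foldr Dis (SOME l. distinct l \<and> set l = A) (\<^bold>\<not> Top)"

definition cn :: "'a set \<Rightarrow> 'a set \<Rightarrow> ('a, 'v) fm"
  where "cn Y X = BigCon (Atom ` Y) \<^bold>\<and> BigCon ((\<lambda>p. \<^bold>\<not> Atom p) ` (X - Y))"

text \<open>
  States contain no decision atoms, so \<open>s \<inter> X\<close> is determined by \<open>X - Dec\<close>. The reduction axiom
  \<open>Red\<close> for \<open>[X]\<close> accordingly ranges over the valuations of \<open>X - Dec\<close>; when \<open>X\<close> contains decision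
  atoms, the variant with \<open>X\<close> in place of \<open>X - Dec\<close> is unsound (take \<open>X = {t x}\<close>, \<open>\<phi> = t x\<close>).
  For \<open>X \<subseteq> Atm - Dec\<close> the two variants are identical.
\<close>

inductive bcl_dc :: "('a, 'v) fm \<Rightarrow> bool" (\<open>\<turnstile> _\<close> [40] 40) where
  Taut: "\<phi> \<in> lang \<Longrightarrow> tautology \<phi> \<Longrightarrow> \<turnstile> \<phi>"
| K: "\<phi> \<in> lang \<Longrightarrow> \<psi> \<in> lang \<Longrightarrow> \<turnstile> (Box {} \<phi> \<^bold>\<and> Box {} (\<phi> \<^bold>\<longrightarrow> \<psi>)) \<^bold>\<longrightarrow> Box {} \<psi>"
| T: "\<phi> \<in> lang \<Longrightarrow> \<turnstile> Box {} \<phi> \<^bold>\<longrightarrow> \<phi>"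
| Four: "\<phi> \<in> lang \<Longrightarrow> \<turnstile> Box {} \<phi> \<^bold>\<longrightarrow> Box {} (Box {} \<phi>)"
| B: "\<phi> \<in> lang \<Longrightarrow> \<turnstile> \<phi> \<^bold>\<longrightarrow> Box {} (Dia {} \<phi>)"
| Red: "X \<subseteq> Idx \<Longrightarrow> \<phi> \<in> lang \<Longrightarrow>
    \<turnstile> Box X \<phi> \<^bold>\<longleftrightarrow>
      BigCon ((\<lambda>Y. cn Y (X - Dec) \<^bold>\<longrightarrow> Box {} (cn Y (X - Dec) \<^bold>\<longrightarrow> \<phi>)) ` Pow (X - Dec))"
| AtLeast: "\<turnstile> BigDis ((\<lambda>x. Atom (t x)) ` Val)"
| AtMost: "x \<in> Val \<Longrightarrow> y \<in> Val \<Longrightarrow> x \<noteq> y \<Longrightarrow> \<turnstile> Atom (t x) \<^bold>\<longrightarrow> \<^bold>\<not> Atom (t y)"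
| Funct: "x \<in> Val \<Longrightarrow>
    \<turnstile> BigCon ((\<lambda>Y. (cn Y (Atm - Dec) \<^bold>\<and> Atom (t x)) \<^bold>\<longrightarrow>
        Box {} (cn Y (Atm - Dec) \<^bold>\<longrightarrow> Atom (t x))) ` Pow (Atm - Dec))"
| Comp: "\<turnstile> BigCon ((\<lambda>Y. Dia {} (cn Y (Atm - Dec))) ` Pow (Atm - Dec))"
| MP: "\<turnstile> \<phi> \<Longrightarrow> \<turnstile> \<phi> \<^bold>\<longrightarrow> \<psi> \<Longrightarrow> \<turnstile> \<psi>"
| Nec: "\<turnstile> \<phi> \<Longrightarrow> \<turnstile> Box {} \<phi>"
| AssignSame: "x \<in> Val \<Longrightarrow> \<phi> \<in> lang \<Longrightarrow>
    \<turnstile> Assign x \<phi> (Atom (t x)) \<^bold>\<longleftrightarrow> (\<phi> \<^bold>\<or> Atom (t x))"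
| AssignOther: "x \<in> Val \<Longrightarrow> y \<in> Val \<Longrightarrow> x \<noteq> y \<Longrightarrow> \<phi> \<in> lang \<Longrightarrow>
    \<turnstile> Assign x \<phi> (Atom (t y)) \<^bold>\<longleftrightarrow> (\<^bold>\<not> \<phi> \<^bold>\<and> Atom (t y))"
| AssignAtom: "x \<in> Val \<Longrightarrow> \<phi> \<in> lang \<Longrightarrow> p \<in> Atm - Dec \<Longrightarrow>
    \<turnstile> Assign x \<phi> (Atom p) \<^bold>\<longleftrightarrow> Atom p"
| AssignNeg: "x \<in> Val \<Longrightarrow> \<phi> \<in> lang \<Longrightarrow> \<psi> \<in> lang \<Longrightarrow>
    \<turnstile> Assign x \<phi> (\<^bold>\<not> \<psi>) \<^bold>\<longleftrightarrow> \<^bold>\<not> Assign x \<phi> \<psi>"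
| AssignCon: "x \<in> Val \<Longrightarrow> \<phi> \<in> lang \<Longrightarrow> \<psi>\<^sub>1 \<in> lang \<Longrightarrow> \<psi>\<^sub>2 \<in> lang \<Longrightarrow>
    \<turnstile> Assign x \<phi> (\<psi>\<^sub>1 \<^bold>\<and> \<psi>\<^sub>2) \<^bold>\<longleftrightarrow> (Assign x \<phi> \<psi>\<^sub>1 \<^bold>\<and> Assign x \<phi> \<psi>\<^sub>2)"
| AssignBox: "x \<in> Val \<Longrightarrow> X \<subseteq> Idx \<Longrightarrow> \<phi> \<in> lang \<Longrightarrow> \<psi> \<in> lang \<Longrightarrow>
    \<turnstile> Assign x \<phi> (Box X \<psi>) \<^bold>\<longleftrightarrow> Box X (Assign x \<phi> \<psi>)"
| RE: "\<turnstile> \<phi>\<^sub>1 \<^bold>\<longleftrightarrow> \<phi>\<^sub>2 \<Longrightarrow> \<psi> \<in> lang \<Longrightarrow> replaces \<phi>\<^sub>1 \<phi>\<^sub>2 \<psi> \<psi>' \<Longrightarrow> \<turnstile> \<psi> \<^bold>\<longleftrightarrow> \<psi>'"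

definition valid :: "('a, 'v) fm \<Rightarrow> bool"
  where "valid \<phi> \<longleftrightarrow> (\<forall>S f. classifier_model S f \<longrightarrow> (\<forall>s\<in>S. sat S f s \<phi>))"

end

end

theory Submission
  imports Defs
begin

text \<open>
  Since everything is finite, a classifier model \<open>f\<close> is described by the boxed formulas
  \<open>[\<emptyset>](cn Y (Atm - Dec) \<longrightarrow> t (f Y))\<close>, and these together with \<open>cn s (Atm - Dec)\<close> prove or refute
  every formula without assignments. The descriptions exhaust all cases: by functionality and S5,
  the logic proves that some \<open>[\<emptyset>](cn Y (Atm - Dec) \<longrightarrow> t x)\<close> holds for each \<open>Y\<close>. Hence a valid
  assignment-free formula is provable, and assignments are eliminated with the reduction axioms,
  from the inside out because no axiom treats two consecutive assignments.
\<close>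

section \<open>Truth-functional evaluation of derived connectives, finite conjunctions and state
  formulas\<close>

lemma truth_value_Dis [simp]:
    "truth_value v (\<phi> \<^bold>\<or> \<psi>) \<longleftrightarrow> truth_value v \<phi> \<or> truth_value v \<psi>"
  and truth_value_Imp [simp]:
    "truth_value v (\<phi> \<^bold>\<longrightarrow> \<psi>) \<longleftrightarrow> (truth_value v \<phi> \<longrightarrow> truth_value v \<psi>)"
  and truth_value_Iff [simp]:
    "truth_value v (\<phi> \<^bold>\<longleftrightarrow> \<psi>) \<longleftrightarrow> (truth_value v \<phi> \<longleftrightarrow> truth_value v \<psi>)"
  and truth_value_Dia [simp]:
    "truth_value v (Dia X \<phi>) \<longleftrightarrow> \<not> truth_value v (Box X (\<^bold>\<not> \<phi>))"
  by (auto simp: Dis_def Imp_def Iff_def Dia_def)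

primrec assignment_free :: "('a, 'v) fm \<Rightarrow> bool" where
  "assignment_free (Atom p) \<longleftrightarrow> True"
| "assignment_free (\<^bold>\<not> \<phi>) \<longleftrightarrow> assignment_free \<phi>"
| "assignment_free (\<phi> \<^bold>\<and> \<psi>) \<longleftrightarrow> assignment_free \<phi> \<and> assignment_free \<psi>"
| "assignment_free (Box X \<phi>) \<longleftrightarrow> assignment_free \<phi>"
| "assignment_free (Assign x \<phi> \<psi>) \<longleftrightarrow> False"

lemma assignment_free_Dis [simp]:
  "assignment_free (\<phi> \<^bold>\<or> \<psi>) \<longleftrightarrow> assignment_free \<phi> \<and> assignment_free \<psi>"
  by (simp add: Dis_def)

text \<open>\<open>Top\<close> is built from an atom chosen in \<open>Atm\<close>, so it belongs to
  the language once some atom exists; the empty case is treated separately at the end.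
  \<open>Idx_subset\<close> covers both intended values of \<open>Idx\<close>.\<close>

locale finite_classifier_logic = classifier_logic Atm Val t Idx
  for Atm :: "'a set" and Val :: "'v set" and t :: "'v \<Rightarrow> 'a" and Idx :: "'a set" +
  assumes finite_Atm: "finite Atm"
    and finite_Val: "finite Val"
    and inj_t: "inj_on t Val"
    and Dec_subset: "t ` Val \<subseteq> Atm"
    and Idx_subset: "Idx \<subseteq> Atm"
    and Atm_nonempty: "Atm \<noteq> {}"
begin

abbreviation States :: "'a set set"
  where "States \<equiv> Pow (Atm - Dec)"

abbreviation state_fm :: "'a set \<Rightarrow> ('a, 'v) fm"
  where "state_fm s \<equiv> cn s (Atm - Dec)"

lemma t_in [simp]: "x \<in> Val \<Longrightarrow> t x \<in> Atm" "x \<in> Val \<Longrightarrow> t x \<in> Dec"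
  using Dec_subset by (auto simp: Dec_def)

lemma finite_States: "finite States"
  using finite_Atm by simp

lemma lang_simps [simp]:
  "Atom p \<in> lang \<longleftrightarrow> p \<in> Atm"
  "\<^bold>\<not> \<phi> \<in> lang \<longleftrightarrow> \<phi> \<in> lang"
  "\<phi> \<^bold>\<and> \<psi> \<in> lang \<longleftrightarrow> \<phi> \<in> lang \<and> \<psi> \<in> lang"
  "Box X \<phi> \<in> lang \<longleftrightarrow> X \<subseteq> Idx \<and> \<phi> \<in> lang"
  "Assign x \<phi> \<psi> \<in> lang \<longleftrightarrow> x \<in> Val \<and> \<phi> \<in> lang \<and> \<psi> \<in> lang"
  "\<phi> \<^bold>\<or> \<psi> \<in> lang \<longleftrightarrow> \<phi> \<in> lang \<and> \<psi> \<in> lang"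
  "\<phi> \<^bold>\<longrightarrow> \<psi> \<in> lang \<longleftrightarrow> \<phi> \<in> lang \<and> \<psi> \<in> lang"
  "(\<phi> \<^bold>\<longleftrightarrow> \<psi>) \<in> lang \<longleftrightarrow> \<phi> \<in> lang \<and> \<psi> \<in> lang"
  "Dia X \<phi> \<in> lang \<longleftrightarrow> X \<subseteq> Idx \<and> \<phi> \<in> lang"
  by (auto simp: lang_def Dis_def Imp_def Iff_def Dia_def)

lemma Top_in_lang [simp]: "Top \<in> lang"
  using Atm_nonempty by (simp add: Top_def Let_def some_in_eq)

lemma truth_value_Top [simp]: "truth_value v Top"
  by (simp add: Top_def Let_def)

lemma enumeration:
  assumes "finite A"
  shows "set (SOME l. distinct l \<and> set l = A) = A"
  using someI_ex[of "\<lambda>l. distinct l \<and> set l = A"] finite_distinct_list[OF assms] by blast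

lemma BigCon_in_lang [simp]:
  assumes "finite A"
  shows "BigCon A \<in> lang \<longleftrightarrow> A \<subseteq> lang"
proof -
  have "foldr Con l Top \<in> lang \<longleftrightarrow> set l \<subseteq> lang" for l
    by (induction l) auto
  then show ?thesis
    by (simp add: BigCon_def enumeration[OF assms])
qed

lemma BigDis_in_lang [simp]:
  assumes "finite A"
  shows "BigDis A \<in> lang \<longleftrightarrow> A \<subseteq> lang"
proof -
  have "foldr Dis l (\<^bold>\<not> Top) \<in> lang \<longleftrightarrow> set l \<subseteq> lang" for l
    by (induction l) auto
  then show ?thesis
    by (simp add: BigDis_def enumeration[OF assms])
qed

lemma truth_value_BigCon [simp]:
  assumes "finite A"
  shows "truth_value v (BigCon A) \<longleftrightarrow> (\<forall>\<phi>\<in>A. truth_value v \<phi>)"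
proof -
  have "truth_value v (foldr Con l Top) \<longleftrightarrow> (\<forall>\<phi>\<in>set l. truth_value v \<phi>)" for l
    by (induction l) auto
  then show ?thesis
    by (simp add: BigCon_def enumeration[OF assms])
qed

lemma truth_value_BigDis [simp]:
  assumes "finite A"
  shows "truth_value v (BigDis A) \<longleftrightarrow> (\<exists>\<phi>\<in>A. truth_value v \<phi>)"
proof -
  have "truth_value v (foldr Dis l (\<^bold>\<not> Top)) \<longleftrightarrow> (\<exists>\<phi>\<in>set l. truth_value v \<phi>)" for l
    by (induction l) auto
  then show ?thesis
    by (simp add: BigDis_def enumeration[OF assms])
qed

lemma finite_subset_Atm: "X \<subseteq> Atm \<Longrightarrow> finite X"
  using finite_Atm finite_subset by blast

lemma cn_in_lang [simp]:
  assumes "Y \<subseteq> Atm" "X \<subseteq> Atm"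
  shows "cn Y X \<in> lang"
  using assms finite_subset_Atm[of Y] finite_subset_Atm[of X] by (auto simp: cn_def)

lemma truth_value_cn:
  assumes "Y \<subseteq> X" "X \<subseteq> Atm"
  shows "truth_value v (cn Y X) \<longleftrightarrow> (\<forall>p\<in>X. truth_value v (Atom p) \<longleftrightarrow> p \<in> Y)"
  using assms finite_subset_Atm[of Y] finite_subset_Atm[of X] by (auto simp: cn_def)

lemma state_fm_in_lang [simp]: "s \<in> States \<Longrightarrow> state_fm s \<in> lang"
  by (intro cn_in_lang) auto

lemma truth_value_state_fm:
  "s \<in> States \<Longrightarrow>
    truth_value v (state_fm s) \<longleftrightarrow> (\<forall>p \<in> Atm - Dec. truth_value v (Atom p) \<longleftrightarrow> p \<in> s)"
  by (intro truth_value_cn) auto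

text \<open>Any valuation, even one that stems from no model, yields a state: the set of nondecision
  atoms it makes true. Case distinctions over states are therefore purely propositional.\<close>

lemma exists_state_fm: "\<exists>s\<in>States. truth_value v (state_fm s)"
proof
  let ?s = "{p \<in> Atm - Dec. truth_value v (Atom p)}"
  show "?s \<in> States" by blast
  then show "truth_value v (state_fm ?s)" by (simp add: truth_value_state_fm)
qed

text \<open>The formula for \<open>s\<close> fixes every atom of \<open>X - Dec\<close>, and
  \<open>s\<close> contains no decision atoms, so \<open>X\<close> and \<open>X - Dec\<close> have
  the same intersection with \<open>s\<close>.\<close>

lemma truth_value_cn_state:
  assumes "s \<in> States" "X \<subseteq> Atm" "Y \<subseteq> X - Dec" "truth_value v (state_fm s)"
  shows "truth_value v (cn Y (X - Dec)) \<longleftrightarrow> s \<inter> X = Y"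
proof -
  have "X - Dec \<subseteq> Atm - Dec"
    using assms(2) by blast
  moreover have "s \<inter> X = s \<inter> (X - Dec)"
    using assms(1) by blast
  ultimately show ?thesis
    using assms truth_value_cn[of Y "X - Dec" v]
    unfolding truth_value_state_fm[OF assms(1)] by blast
qed


subsection \<open>Soundness\<close>

lemma truth_value_sat: "truth_value (sat S f s) \<phi> \<longleftrightarrow> sat S f s \<phi>"
  by (induction \<phi>) auto

lemma sat_simps [simp]:
  "sat S f s (\<phi> \<^bold>\<or> \<psi>) \<longleftrightarrow> sat S f s \<phi> \<or> sat S f s \<psi>"
  "sat S f s (\<phi> \<^bold>\<longrightarrow> \<psi>) \<longleftrightarrow> (sat S f s \<phi> \<longrightarrow> sat S f s \<psi>)"
  "sat S f s (\<phi> \<^bold>\<longleftrightarrow> \<psi>) \<longleftrightarrow> (sat S f s \<phi> \<longleftrightarrow> sat S f s \<psi>)"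
  "sat S f s (Dia X \<phi>) \<longleftrightarrow> (\<exists>s'\<in>S. s \<inter> X = s' \<inter> X \<and> sat S f s' \<phi>)"
  by (auto simp: Dis_def Imp_def Iff_def Dia_def)

lemma sat_BigCon [simp]:
  "finite A \<Longrightarrow> sat S f s (BigCon A) \<longleftrightarrow> (\<forall>\<phi>\<in>A. sat S f s \<phi>)"
  using truth_value_BigCon[of A "sat S f s"] by (simp add: truth_value_sat)

lemma sat_BigDis [simp]:
  "finite A \<Longrightarrow> sat S f s (BigDis A) \<longleftrightarrow> (\<exists>\<phi>\<in>A. sat S f s \<phi>)"
  using truth_value_BigDis[of A "sat S f s"] by (simp add: truth_value_sat)

lemma sat_decision [simp]: "x \<in> Val \<Longrightarrow> sat S f s (Atom (t x)) \<longleftrightarrow> f s = x"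
  using inj_t by (auto dest: inj_onD)

lemma sat_nondecision [simp]: "p \<notin> Dec \<Longrightarrow> sat S f s (Atom p) \<longleftrightarrow> p \<in> s"
  by simp

declare sat.simps(1) [simp del]

lemma sat_state_fm:
  assumes "s \<in> States" "Y \<in> States"
  shows "sat S f s (state_fm Y) \<longleftrightarrow> s = Y"
  using assms truth_value_state_fm[of Y "sat S f s"] by (auto simp: truth_value_sat)

lemma sat_cn:
  assumes "s \<in> States" "X \<subseteq> Atm" "Y \<subseteq> X - Dec"
  shows "sat S f s (cn Y (X - Dec)) \<longleftrightarrow> s \<inter> X = Y"
  using truth_value_cn_state[OF assms, of "sat S f s"] sat_state_fm[OF assms(1) assms(1)]
  by (simp add: truth_value_sat)

text \<open>Exchanging the condition of an assignment for an equivalent one gives functions that are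
  known to agree only on \<open>S\<close>. The functions are generalised in the induction because
  assignments change them, the state because boxes change it.\<close>

lemma sat_cong:
  assumes "\<And>s. s \<in> S \<Longrightarrow> f s = g s" "s \<in> S"
  shows "sat S f s \<phi> \<longleftrightarrow> sat S g s \<phi>"
  using assms
proof (induction \<phi> arbitrary: f g s)
  case (Atom p)
  from Atom.prems(1)[OF Atom.prems(2)] show ?case
    unfolding sat.simps by (rule ssubst) (rule refl)
next
  case (Neg \<phi>)
  from Neg.IH[of f g s] Neg.prems show ?case by simp
next
  case (Con \<phi> \<psi>)
  from Con.IH(1)[of f g s] Con.IH(2)[of f g s] Con.prems show ?case by simp
next
  case (Box X \<phi>)
  have "sat S f s' \<phi> \<longleftrightarrow> sat S g s' \<phi>" if "s' \<in> S" for s'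
    using Box.IH[of f g s'] Box.prems(1) that by blast
  then show ?case by auto
next
  case (Assign x \<phi> \<psi>)
  have \<phi>: "sat S f s' \<phi> \<longleftrightarrow> sat S g s' \<phi>" if "s' \<in> S" for s'
    using Assign.IH(1)[of f g s'] Assign.prems(1) that by blast
  have "(if sat S f s' \<phi> then x else f s') = (if sat S g s' \<phi> then x else g s')"
    if "s' \<in> S" for s'
    by (simp only: \<phi>[OF that] Assign.prems(1)[OF that])
  from Assign.IH(2)[OF this Assign.prems(2)] show ?case
    by (simp only: sat.simps)
qed

text \<open>The equivalence is assumed in all models over \<open>S\<close>, not just at
  \<open>f\<close>, because occurrences in the scope of an assignment are evaluated in an updated
  model.\<close>

lemma sat_replaces:
  assumes "\<And>f s. f ` S \<subseteq> Val \<Longrightarrow> s \<in> S \<Longrightarrow> sat S f s \<phi>\<^sub>1 \<longleftrightarrow> sat S f s \<phi>\<^sub>2"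
    and "replaces \<phi>\<^sub>1 \<phi>\<^sub>2 \<psi> \<psi>'" "\<psi> \<in> lang" "f ` S \<subseteq> Val" "s \<in> S"
  shows "sat S f s \<psi> \<longleftrightarrow> sat S f s \<psi>'"
  using assms(2-)
proof (induction arbitrary: f s rule: replaces.induct)
  case here
  then show ?case using assms(1) by blast
next
  case (assign \<psi> \<psi>' \<chi> \<chi>' x)
  let ?f = "\<lambda>\<psi> s'. if sat S f s' \<psi> then x else f s'"
  \<comment> \<open>The condition is exchanged first, which leaves the updated function unchanged on
    \<open>S\<close>; then the scope is exchanged in the updated model, whose values stay in
    \<open>Val\<close> because \<open>x\<close> lies there.\<close>
  have "sat S (?f \<psi>) s \<chi> \<longleftrightarrow> sat S (?f \<psi>') s \<chi>"
    by (rule sat_cong) (use assign in auto)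
  also have "\<dots> \<longleftrightarrow> sat S (?f \<psi>') s \<chi>'"
    by (rule assign.IH(2)) (use assign.prems in auto)
  finally show ?case by simp
qed auto

lemma replaces_in_lang:
  assumes "replaces \<phi>\<^sub>1 \<phi>\<^sub>2 \<psi> \<psi>'" "\<phi>\<^sub>2 \<in> lang" "\<psi> \<in> lang"
  shows "\<psi>' \<in> lang"
  using assms by (induction rule: replaces.induct) auto

lemma provable_in_lang: "\<turnstile> \<phi> \<Longrightarrow> \<phi> \<in> lang"
proof (induction rule: bcl_dc.induct)
  case (Red X \<phi>)
  then have "X \<subseteq> Atm" using Idx_subset by blast
  moreover from this have "cn Y (X - Dec) \<in> lang" if "Y \<subseteq> X - Dec" for Y
    using that by (intro cn_in_lang) blast+
  ultimately show ?case
    using Red finite_subset_Atm[of X] by auto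
next
  case (RE \<phi>\<^sub>1 \<phi>\<^sub>2 \<psi> \<psi>')
  then show ?case using replaces_in_lang by auto
qed (use finite_Atm finite_Val in auto)

text \<open>\<open>f\<close> and \<open>s\<close> are generalised: \<open>Nec\<close> uses its
  premise at every state, and \<open>RE\<close> uses its premise in updated models. For
  \<open>Red\<close>, exactly one valuation of \<open>X - Dec\<close> holds at a given state; for
  \<open>Funct\<close> and \<open>Comp\<close>, a state formula holds at exactly its own
  state.\<close>

lemma sound:
  assumes "\<turnstile> \<phi>" "f ` States \<subseteq> Val" "s \<in> States"
  shows "sat States f s \<phi>"
  using assms
proof (induction arbitrary: f s rule: bcl_dc.induct)
  case (Taut \<phi>)
  then show ?case
    using truth_value_sat[of States f s \<phi>] by (simp add: tautology_def)
next
  case (Red X \<phi>)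
  then have "X \<subseteq> Atm" using Idx_subset by blast
  then show ?case
    using Red finite_subset_Atm[of X] by (auto simp: sat_cn)
next
  case AtLeast
  then show ?case using finite_Val by auto
next
  case (RE \<phi>\<^sub>1 \<phi>\<^sub>2 \<psi> \<psi>')
  show ?case
    using sat_replaces[of States \<phi>\<^sub>1 \<phi>\<^sub>2 \<psi> \<psi>' f s] RE by simp
next
  case (Funct x)
  then show ?case using finite_Atm by (auto simp: sat_state_fm)
next
  case Comp
  then show ?case using finite_Atm by (auto simp: sat_state_fm)
qed auto


subsection \<open>Entailment from hypotheses\<close>

text \<open>The theorems in \<open>\<Theta>\<close> become antecedents of a single tautology and are
  detached by \<open>MP\<close>. Propositional derivations can thus be replaced by arguments about
  valuations.\<close>

lemma provable_if_consequence:
  assumes "finite \<Theta>" "\<And>\<theta>. \<theta> \<in> \<Theta> \<Longrightarrow> \<turnstile> \<theta>" "\<phi> \<in> lang"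
    "\<And>v. \<forall>\<theta>\<in>\<Theta>. truth_value v \<theta> \<Longrightarrow> truth_value v \<phi>"
  shows "\<turnstile> \<phi>"
  using assms
proof (induction \<Theta> arbitrary: \<phi> rule: finite_induct)
  case empty
  then show ?case by (intro Taut) (simp_all add: tautology_def)
next
  case (insert \<theta> \<Theta>)
  have "\<turnstile> \<theta>" using insert.prems(1) by blast
  moreover have "\<turnstile> \<theta> \<^bold>\<longrightarrow> \<phi>"
  proof (rule insert.IH)
    show "\<theta> \<^bold>\<longrightarrow> \<phi> \<in> lang"
      using provable_in_lang[OF \<open>\<turnstile> \<theta>\<close>] insert.prems(2) by simp
    show "truth_value v (\<theta> \<^bold>\<longrightarrow> \<phi>)" if "\<forall>\<theta>\<in>\<Theta>. truth_value v \<theta>" for v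
      using that insert.prems(3)[of v] by simp
  qed (rule insert.prems(1), rule insertI2)
  ultimately show ?case by (rule MP)
qed

text \<open>This is local consequence: hypotheses act only propositionally, beside finitely many
  theorems. Necessitation is applied to theorems alone, which is what makes the deduction theorem
  immediate.\<close>

definition entails :: "('a, 'v) fm set \<Rightarrow> ('a, 'v) fm \<Rightarrow> bool" (infix \<open>\<tturnstile>\<close> 40)
  where "\<Gamma> \<tturnstile> \<phi> \<longleftrightarrow> \<phi> \<in> lang \<and> (\<exists>\<Theta>. finite \<Theta> \<and> (\<forall>\<theta>\<in>\<Theta>. \<turnstile> \<theta>) \<and>
    (\<forall>v. (\<forall>\<gamma>\<in>\<Gamma>. truth_value v \<gamma>) \<longrightarrow> (\<forall>\<theta>\<in>\<Theta>. truth_value v \<theta>) \<longrightarrow> truth_value v \<phi>))"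

lemma entails_in_lang: "\<Gamma> \<tturnstile> \<phi> \<Longrightarrow> \<phi> \<in> lang"
  by (simp add: entails_def)

lemma entailsI:
  assumes "\<phi> \<in> lang" "finite \<Theta>" "\<And>\<theta>. \<theta> \<in> \<Theta> \<Longrightarrow> \<turnstile> \<theta>"
    and "\<And>v. \<forall>\<gamma>\<in>\<Gamma>. truth_value v \<gamma> \<Longrightarrow> \<forall>\<theta>\<in>\<Theta>. truth_value v \<theta> \<Longrightarrow> truth_value v \<phi>"
  shows "\<Gamma> \<tturnstile> \<phi>"
  unfolding entails_def using assms by (intro conjI exI[of _ \<Theta>]) simp_all

lemma entailsE:
  assumes "\<Gamma> \<tturnstile> \<phi>"
  obtains \<Theta> where "finite \<Theta>" "\<And>\<theta>. \<theta> \<in> \<Theta> \<Longrightarrow> \<turnstile> \<theta>"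
    "\<And>v. \<forall>\<gamma>\<in>\<Gamma>. truth_value v \<gamma> \<Longrightarrow> \<forall>\<theta>\<in>\<Theta>. truth_value v \<theta> \<Longrightarrow> truth_value v \<phi>"
proof -
  obtain \<Theta> where "finite \<Theta>" "\<forall>\<theta>\<in>\<Theta>. \<turnstile> \<theta>"
    "\<forall>v. (\<forall>\<gamma>\<in>\<Gamma>. truth_value v \<gamma>) \<longrightarrow> (\<forall>\<theta>\<in>\<Theta>. truth_value v \<theta>) \<longrightarrow> truth_value v \<phi>"
    using assms unfolding entails_def by (elim conjE exE)
  then show thesis
    by (intro that[of \<Theta>]) simp_all
qed

lemma provable_iff_entails: "\<turnstile> \<phi> \<longleftrightarrow> {} \<tturnstile> \<phi>"
proof
  assume "\<turnstile> \<phi>"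
  then show "{} \<tturnstile> \<phi>"
    by (intro entailsI[of _ "{\<phi>}"]) (simp_all add: provable_in_lang)
next
  assume *: "{} \<tturnstile> \<phi>"
  then show "\<turnstile> \<phi>"
    by (rule entailsE) (rule provable_if_consequence, simp_all add: entails_in_lang[OF *])
qed

lemma entails_mono:
  assumes "\<Gamma> \<tturnstile> \<phi>" "\<Gamma> \<subseteq> \<Delta>"
  shows "\<Delta> \<tturnstile> \<phi>"
proof -
  from assms(1) obtain \<Theta> where \<Theta>: "finite \<Theta>" "\<And>\<theta>. \<theta> \<in> \<Theta> \<Longrightarrow> \<turnstile> \<theta>"
    "\<And>v. \<forall>\<gamma>\<in>\<Gamma>. truth_value v \<gamma> \<Longrightarrow> \<forall>\<theta>\<in>\<Theta>. truth_value v \<theta> \<Longrightarrow> truth_value v \<phi>"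
    by (rule entailsE) (rule that)
  show ?thesis
    by (rule entailsI[OF entails_in_lang[OF assms(1)] \<Theta>])
      (use assms(2) in \<open>auto dest: subsetD\<close>)
qed

lemma entails_provable: "\<turnstile> \<phi> \<Longrightarrow> \<Gamma> \<tturnstile> \<phi>"
  unfolding provable_iff_entails by (erule entails_mono) simp

text \<open>Entailment is closed under propositional consequence: the finite sets of theorems behind
  the members of \<open>A\<close> are chosen and united, and the union is again finite.\<close>

lemma entails_consequence:
  assumes "finite A" "\<And>\<alpha>. \<alpha> \<in> A \<Longrightarrow> \<Gamma> \<tturnstile> \<alpha>" "\<phi> \<in> lang"
    and "\<And>v. \<forall>\<gamma>\<in>\<Gamma>. truth_value v \<gamma> \<Longrightarrow> \<forall>\<alpha>\<in>A. truth_value v \<alpha> \<Longrightarrow> truth_value v \<phi>"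
  shows "\<Gamma> \<tturnstile> \<phi>"
proof -
  have "\<forall>\<alpha>\<in>A. \<exists>\<Theta>. finite \<Theta> \<and> (\<forall>\<theta>\<in>\<Theta>. \<turnstile> \<theta>) \<and>
      (\<forall>v. (\<forall>\<gamma>\<in>\<Gamma>. truth_value v \<gamma>) \<longrightarrow> (\<forall>\<theta>\<in>\<Theta>. truth_value v \<theta>) \<longrightarrow> truth_value v \<alpha>)"
  proof
    fix \<alpha> assume "\<alpha> \<in> A"
    from assms(2)[OF this] show "\<exists>\<Theta>. finite \<Theta> \<and> (\<forall>\<theta>\<in>\<Theta>. \<turnstile> \<theta>) \<and>
      (\<forall>v. (\<forall>\<gamma>\<in>\<Gamma>. truth_value v \<gamma>) \<longrightarrow> (\<forall>\<theta>\<in>\<Theta>. truth_value v \<theta>) \<longrightarrow> truth_value v \<alpha>)"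
      by (simp add: entails_def)
  qed
  from bchoice[OF this] obtain \<Theta> where \<Theta>: "\<forall>\<alpha>\<in>A. finite (\<Theta> \<alpha>) \<and> (\<forall>\<theta>\<in>\<Theta> \<alpha>. \<turnstile> \<theta>) \<and>
      (\<forall>v. (\<forall>\<gamma>\<in>\<Gamma>. truth_value v \<gamma>) \<longrightarrow> (\<forall>\<theta>\<in>\<Theta> \<alpha>. truth_value v \<theta>) \<longrightarrow> truth_value v \<alpha>)" ..
  show ?thesis
  proof (rule entailsI[of _ "\<Union>\<alpha>\<in>A. \<Theta> \<alpha>"])
    show "\<turnstile> \<theta>" if "\<theta> \<in> (\<Union>\<alpha>\<in>A. \<Theta> \<alpha>)" for \<theta>
      using that \<Theta> by auto
    show "truth_value v \<phi>"
      if "\<forall>\<gamma>\<in>\<Gamma>. truth_value v \<gamma>" "\<forall>\<theta> \<in> (\<Union>\<alpha>\<in>A. \<Theta> \<alpha>). truth_value v \<theta>" for v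
      using that \<Theta> by (intro assms(4)) simp_all
  qed (use assms(1,3) \<Theta> in simp_all)
qed

lemma entails_hyp: "\<phi> \<in> \<Gamma> \<Longrightarrow> \<phi> \<in> lang \<Longrightarrow> \<Gamma> \<tturnstile> \<phi>"
  by (rule entails_consequence[of "{}"]) auto

lemma deduction:
  assumes "insert \<alpha> \<Gamma> \<tturnstile> \<phi>" "\<alpha> \<in> lang"
  shows "\<Gamma> \<tturnstile> \<alpha> \<^bold>\<longrightarrow> \<phi>"
proof -
  from assms(1) obtain \<Theta> where \<Theta>: "finite \<Theta>" "\<And>\<theta>. \<theta> \<in> \<Theta> \<Longrightarrow> \<turnstile> \<theta>"
    "\<And>v. \<forall>\<gamma>\<in>insert \<alpha> \<Gamma>. truth_value v \<gamma> \<Longrightarrow> \<forall>\<theta>\<in>\<Theta>. truth_value v \<theta> \<Longrightarrow> truth_value v \<phi>"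
    by (rule entailsE) (rule that)
  show ?thesis
    by (rule entailsI[OF _ \<Theta>(1,2)]) (use assms(2) entails_in_lang[OF assms(1)] \<Theta>(3) in simp_all)
qed

section \<open>Modal reasoning in S5 and single instances of the axioms on state formulas\<close>

lemma entails_Box_MP:
  assumes "\<Gamma> \<tturnstile> Box {} (\<phi> \<^bold>\<longrightarrow> \<psi>)" "\<Gamma> \<tturnstile> Box {} \<phi>"
  shows "\<Gamma> \<tturnstile> Box {} \<psi>"
proof -
  have [simp]: "\<phi> \<in> lang" "\<psi> \<in> lang"
    using assms[THEN entails_in_lang] by auto
  show ?thesis
    by (rule entails_consequence[of "{Box {} (\<phi> \<^bold>\<longrightarrow> \<psi>), Box {} \<phi>,
        (Box {} \<phi> \<^bold>\<and> Box {} (\<phi> \<^bold>\<longrightarrow> \<psi>)) \<^bold>\<longrightarrow> Box {} \<psi>}"])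
      (use assms entails_provable[OF K[of \<phi> \<psi>]] in auto)
qed

text \<open>Necessitation under hypotheses is admissible when these are boxed themselves. Each
  hypothesis is moved into an antecedent, the implication is boxed by induction, and
  \<open>K\<close> with \<open>Four\<close> recovers the hypothesis.\<close>

lemma entails_Box:
  assumes "finite \<Gamma>" "\<Gamma> \<subseteq> Box {} ` lang" "\<Gamma> \<tturnstile> \<phi>"
  shows "\<Gamma> \<tturnstile> Box {} \<phi>"
  using assms
proof (induction \<Gamma> arbitrary: \<phi> rule: finite_induct)
  case empty
  then show ?case using Nec by (simp add: provable_iff_entails[symmetric])
next
  case (insert \<beta> \<Gamma>)
  then obtain \<alpha> where \<alpha>: "\<beta> = Box {} \<alpha>" "\<alpha> \<in> lang" by auto
  have "\<Gamma> \<tturnstile> \<beta> \<^bold>\<longrightarrow> \<phi>"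
    using insert.prems \<alpha> by (intro deduction) auto
  then have "\<Gamma> \<tturnstile> Box {} (\<beta> \<^bold>\<longrightarrow> \<phi>)"
    using insert.IH insert.prems(1) by simp
  then have "insert \<beta> \<Gamma> \<tturnstile> Box {} (\<beta> \<^bold>\<longrightarrow> \<phi>)"
    using entails_mono by blast
  moreover have "insert \<beta> \<Gamma> \<tturnstile> Box {} \<beta>"
    by (rule entails_consequence[of "{Box {} \<alpha> \<^bold>\<longrightarrow> Box {} (Box {} \<alpha>)}"])
      (use \<alpha> entails_provable[OF Four[of \<alpha>]] in auto)
  ultimately show ?case by (rule entails_Box_MP)
qed

text \<open>Negative introspection comes from \<open>B\<close> and \<open>Four\<close>. With
  \<open>?N\<close> for the negated box, \<open>Four\<close> gives \<open>Box {} \<alpha>\<close>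
  implies \<open>Box {}\<close> of the negation of \<open>?N\<close>; contraposition gives
  \<open>Dia {} ?N\<close> implies \<open>?N\<close>. Boxing this and applying \<open>B\<close> to
  \<open>?N\<close> gives \<open>Box {} ?N\<close>.\<close>

lemma provable_Five:
  assumes [simp]: "\<alpha> \<in> lang"
  shows "\<turnstile> \<^bold>\<not> Box {} \<alpha> \<^bold>\<longrightarrow> Box {} (\<^bold>\<not> Box {} \<alpha>)"
proof -
  let ?N = "\<^bold>\<not> Box {} \<alpha>"
  have "{Box {} \<alpha>} \<tturnstile> Box {} (\<^bold>\<not> ?N)"
    by (rule entails_Box) (auto intro!: entails_consequence[of "{}"])
  then have "{} \<tturnstile> Box {} \<alpha> \<^bold>\<longrightarrow> Box {} (\<^bold>\<not> ?N)"
    by (intro deduction) auto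
  then have "{} \<tturnstile> Dia {} ?N \<^bold>\<longrightarrow> ?N"
    by - (rule entails_consequence[of "{Box {} \<alpha> \<^bold>\<longrightarrow> Box {} (\<^bold>\<not> ?N)}"], auto)
  then have "{} \<tturnstile> Box {} (Dia {} ?N \<^bold>\<longrightarrow> ?N)"
    by (rule entails_Box[rotated 2]) auto
  then have "{?N} \<tturnstile> Box {} (Dia {} ?N \<^bold>\<longrightarrow> ?N)"
    using entails_mono by blast
  moreover have "{?N} \<tturnstile> Box {} (Dia {} ?N)"
    by (rule entails_consequence[of "{?N \<^bold>\<longrightarrow> Box {} (Dia {} ?N)}"])
      (auto intro!: entails_provable B simp del: truth_value_Dia)
  ultimately have "{?N} \<tturnstile> Box {} ?N"
    by (rule entails_Box_MP)
  then show ?thesis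
    unfolding provable_iff_entails by (intro deduction) auto
qed

lemma provable_Comp: "Y \<in> States \<Longrightarrow> \<turnstile> Dia {} (state_fm Y)"
  by (rule provable_if_consequence[where
        \<Theta> = "{BigCon ((\<lambda>Y. Dia {} (state_fm Y)) ` States)}"])
    (use Comp finite_States in auto)

lemma provable_Funct:
  assumes "x \<in> Val" "Y \<in> States"
  shows "\<turnstile> (state_fm Y \<^bold>\<and> Atom (t x)) \<^bold>\<longrightarrow> Box {} (state_fm Y \<^bold>\<longrightarrow> Atom (t x))"
  by (rule provable_if_consequence[where
        \<Theta> = "{BigCon ((\<lambda>Y. (state_fm Y \<^bold>\<and> Atom (t x)) \<^bold>\<longrightarrow>
          Box {} (state_fm Y \<^bold>\<longrightarrow> Atom (t x))) ` States)}"])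
    (use Funct[OF assms(1)] assms finite_States in auto)


subsection \<open>Assignment-free formulas\<close>

text \<open>The formulas are boxed so that they remain available under \<open>Box {}\<close> by
  \<open>entails_Box\<close>. The set \<open>A\<close> permits partial descriptions, which grow by
  one state at a time in the exhaustion argument.\<close>

definition description :: "'a set set \<Rightarrow> ('a set \<Rightarrow> 'v) \<Rightarrow> ('a, 'v) fm set"
  where "description A f = (\<lambda>Y. Box {} (state_fm Y \<^bold>\<longrightarrow> Atom (t (f Y)))) ` A"

lemma description_boxed:
  assumes "f ` States \<subseteq> Val"
  shows "finite (description States f)" "description States f \<subseteq> Box {} ` lang"
  using assms finite_States by (auto simp: description_def image_subset_iff intro!: imageI)

lemma description_decision:
  assumes "f ` States \<subseteq> Val" "s \<in> States"
  shows "insert (state_fm s) (description States f) \<tturnstile> Atom (t (f s))"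
proof -
  let ?\<delta> = "state_fm s \<^bold>\<longrightarrow> Atom (t (f s))"
  have "f s \<in> Val" using assms by blast
  then have "?\<delta> \<in> lang" using assms(2) by simp
  moreover have "Box {} ?\<delta> \<in> description States f"
    using assms(2) by (auto simp: description_def)
  ultimately show ?thesis
    using \<open>f s \<in> Val\<close> entails_provable[OF T[of ?\<delta>]]
    by - (rule entails_consequence[of "{Box {} ?\<delta> \<^bold>\<longrightarrow> ?\<delta>}"], auto)
qed

lemma entails_cases_state:
  assumes "\<phi> \<in> lang" "\<And>s. s \<in> States \<Longrightarrow> insert (state_fm s) \<Gamma> \<tturnstile> \<phi>"
  shows "\<Gamma> \<tturnstile> \<phi>"
proof (rule entails_consequence[of "(\<lambda>s. state_fm s \<^bold>\<longrightarrow> \<phi>) ` States"])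
  show "truth_value v \<phi>" if "\<forall>\<alpha> \<in> (\<lambda>s. state_fm s \<^bold>\<longrightarrow> \<phi>) ` States. truth_value v \<alpha>" for v
    using exists_state_fm[of v] that by auto
qed (use assms finite_States in \<open>auto intro!: deduction\<close>)

text \<open>The existential hides the large conjunction of the axiom and exposes only its truth
  condition.\<close>

lemma provable_Red:
  assumes "X \<subseteq> Idx" "\<phi> \<in> lang"
  shows "\<exists>\<rho>. \<turnstile> \<rho> \<and> (\<forall>v. truth_value v \<rho> \<longrightarrow>
    (truth_value v (Box X \<phi>) \<longleftrightarrow> (\<forall>Y \<subseteq> X - Dec. truth_value v (cn Y (X - Dec)) \<longrightarrow>
      truth_value v (Box {} (cn Y (X - Dec) \<^bold>\<longrightarrow> \<phi>)))))"
proof -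
  have "finite X"
    using assms(1) Idx_subset finite_subset_Atm by blast
  then show ?thesis
    by - (rule exI, rule conjI, rule Red[OF assms], auto)
qed

text \<open>The state \<open>s\<close> falsifies the antecedents of all other conjuncts of the reduction axiom.\<close>

lemma entails_Box_iff:
  assumes "X \<subseteq> Idx" "\<phi> \<in> lang" "s \<in> States"
  shows "{state_fm s} \<tturnstile> Box X \<phi> \<^bold>\<longleftrightarrow> Box {} (cn (s \<inter> X) (X - Dec) \<^bold>\<longrightarrow> \<phi>)"
proof -
  have X: "X \<subseteq> Atm" and s: "s \<inter> X \<subseteq> X - Dec"
    using assms Idx_subset by auto
  obtain \<rho> where "\<turnstile> \<rho>" and \<rho>: "\<And>v. truth_value v \<rho> \<Longrightarrow>
      (truth_value v (Box X \<phi>) \<longleftrightarrow> (\<forall>Y \<subseteq> X - Dec. truth_value v (cn Y (X - Dec)) \<longrightarrow>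
        truth_value v (Box {} (cn Y (X - Dec) \<^bold>\<longrightarrow> \<phi>))))"
    using provable_Red[OF assms(1,2)] by blast
  show ?thesis
  proof (rule entails_consequence[of "{\<rho>}"])
    show "truth_value v (Box X \<phi> \<^bold>\<longleftrightarrow> Box {} (cn (s \<inter> X) (X - Dec) \<^bold>\<longrightarrow> \<phi>))"
      if "\<forall>\<gamma>\<in>{state_fm s}. truth_value v \<gamma>" "\<forall>\<alpha>\<in>{\<rho>}. truth_value v \<alpha>" for v
      using \<rho>[of v] truth_value_cn_state[OF assms(3) X] that s by auto
  qed (use assms X s \<open>\<turnstile> \<rho>\<close> in \<open>auto intro!: entails_provable cn_in_lang\<close>)
qed

text \<open>The state formula settles nondecision atoms, the description together with
  \<open>AtMost\<close> settles decision atoms, and \<open>entails_Box_iff\<close> reduces every box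
  to \<open>Box {}\<close>. Only \<open>s\<close> varies in the induction: a box looks at other
  states of the same classifier.\<close>

lemma description_decides:
  assumes "assignment_free \<phi>" "\<phi> \<in> lang" "f ` States \<subseteq> Val" "s \<in> States"
  shows "insert (state_fm s) (description States f) \<tturnstile>
    (if sat States f s \<phi> then \<phi> else \<^bold>\<not> \<phi>)"
  using assms
proof (induction \<phi> arbitrary: s)
  case (Atom p)
  show ?case
  proof (cases "p \<in> Dec")
    case True
    then obtain x where x: "x \<in> Val" "p = t x" by (auto simp: Dec_def)
    have fs: "f s \<in> Val" using Atom.prems by auto
    note dec = description_decision[OF Atom.prems(3,4)]
    show ?thesis
    proof (cases "f s = x")
      case True
      with dec x show ?thesis by simp
    next
      case False
      have "insert (state_fm s) (description States f) \<tturnstile> \<^bold>\<not> Atom (t x)"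
        by (rule entails_consequence[of "{Atom (t (f s)), Atom (t (f s)) \<^bold>\<longrightarrow> \<^bold>\<not> Atom (t x)}"])
          (use dec x fs False in \<open>auto intro: entails_provable AtMost\<close>)
      with False x show ?thesis by simp
    qed
  next
    case False
    then show ?thesis
      using Atom.prems by - (rule entails_consequence[of "{}"], auto simp: truth_value_state_fm)
  qed
next
  case (Neg \<phi>)
  then have "insert (state_fm s) (description States f) \<tturnstile>
      (if sat States f s \<phi> then \<phi> else \<^bold>\<not> \<phi>)" by simp
  then show ?case
    by - (rule entails_consequence[of "{if sat States f s \<phi> then \<phi> else \<^bold>\<not> \<phi>}"],
      use Neg.prems in auto)
next
  case (Con \<phi> \<psi>)
  then have "insert (state_fm s) (description States f) \<tturnstile>
      (if sat States f s \<phi> then \<phi> else \<^bold>\<not> \<phi>)"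
    "insert (state_fm s) (description States f) \<tturnstile>
      (if sat States f s \<psi> then \<psi> else \<^bold>\<not> \<psi>)" by simp_all
  then show ?case
    by - (rule entails_consequence[of "{if sat States f s \<phi> then \<phi> else \<^bold>\<not> \<phi>,
        if sat States f s \<psi> then \<psi> else \<^bold>\<not> \<psi>}"],
      use Con.prems in \<open>auto split: if_splits\<close>)
next
  case (Box X \<phi>)
  let ?D = "description States f"
  let ?c = "cn (s \<inter> X) (X - Dec)"
  have X: "X \<subseteq> Idx" "X \<subseteq> Atm" and \<phi> [simp]: "\<phi> \<in> lang" and sX: "s \<inter> X \<subseteq> X - Dec"
    using Box.prems Idx_subset by auto
  have c [simp]: "?c \<in> lang"
    using X by (intro cn_in_lang) auto
  note boxed = description_boxed[OF Box.prems(3)]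
  note IH = Box.IH[OF _ \<phi> Box.prems(3)]
  have iff: "insert (state_fm s) ?D \<tturnstile> Box X \<phi> \<^bold>\<longleftrightarrow> Box {} (?c \<^bold>\<longrightarrow> \<phi>)"
    using entails_Box_iff[OF X(1) \<phi> Box.prems(4)] entails_mono by blast
  show ?case
  proof (cases "sat States f s (Box X \<phi>)")
    case True
    \<comment> \<open>The hypothesis on \<open>s\<close> is left out, since only the boxed
      description may be carried under \<open>Box {}\<close>. Each state \<open>s'\<close> either
      agrees with \<open>s\<close> on \<open>X\<close>, and then \<open>\<phi>\<close> follows by
      induction, or falsifies \<open>?c\<close>.\<close>
    have "?D \<tturnstile> ?c \<^bold>\<longrightarrow> \<phi>"
    proof (rule entails_cases_state)
      fix s' assume s': "s' \<in> States"
      let ?L = "if sat States f s' \<phi> then \<phi> else \<^bold>\<not> \<phi>"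
      show "insert (state_fm s') ?D \<tturnstile> ?c \<^bold>\<longrightarrow> \<phi>"
      proof (rule entails_consequence[of "{?L}"])
        show "truth_value v (?c \<^bold>\<longrightarrow> \<phi>)"
          if "\<forall>\<gamma> \<in> insert (state_fm s') ?D. truth_value v \<gamma>" "\<forall>\<alpha>\<in>{?L}. truth_value v \<alpha>" for v
          using that True s' truth_value_cn_state[OF s' X(2) sX, of v] by auto
      qed (use IH[OF _ s'] Box.prems in auto)
    qed simp
    then have "?D \<tturnstile> Box {} (?c \<^bold>\<longrightarrow> \<phi>)"
      using boxed by (intro entails_Box)
    then have "insert (state_fm s) ?D \<tturnstile> Box {} (?c \<^bold>\<longrightarrow> \<phi>)"
      using entails_mono by blast
    with iff have "insert (state_fm s) ?D \<tturnstile> Box X \<phi>"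
      using X by - (rule entails_consequence[of "{Box X \<phi> \<^bold>\<longleftrightarrow> Box {} (?c \<^bold>\<longrightarrow> \<phi>),
        Box {} (?c \<^bold>\<longrightarrow> \<phi>)}"], auto)
    with True show ?thesis by simp
  next
    case False
    then obtain s' where s': "s' \<in> States" "s' \<inter> X = s \<inter> X" "\<not> sat States f s' \<phi>"
      by auto
    have "insert (state_fm s') ?D \<tturnstile> \<^bold>\<not> \<phi>"
      using IH[OF _ s'(1)] Box.prems s' by simp
    then have "?D \<tturnstile> state_fm s' \<^bold>\<longrightarrow> \<^bold>\<not> \<phi>"
      using s' by (intro deduction) auto
    \<comment> \<open>The counterexample \<open>s'\<close> agrees with \<open>s\<close> on
      \<open>X\<close>, so its state formula makes \<open>?c\<close> true and contradicts
      \<open>?c\<close> implying \<open>\<phi>\<close>.\<close>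
    then have "?D \<tturnstile> (?c \<^bold>\<longrightarrow> \<phi>) \<^bold>\<longrightarrow> \<^bold>\<not> state_fm s'"
      using s' truth_value_cn_state[OF s'(1) X(2) sX]
      by - (rule entails_consequence[of "{state_fm s' \<^bold>\<longrightarrow> \<^bold>\<not> \<phi>}"], auto)
    then have "?D \<tturnstile> Box {} ((?c \<^bold>\<longrightarrow> \<phi>) \<^bold>\<longrightarrow> \<^bold>\<not> state_fm s')"
      using boxed by (intro entails_Box)
    then have "insert (Box {} (?c \<^bold>\<longrightarrow> \<phi>)) ?D \<tturnstile> Box {} ((?c \<^bold>\<longrightarrow> \<phi>) \<^bold>\<longrightarrow> \<^bold>\<not> state_fm s')"
      by (rule entails_mono) blast
    moreover have "insert (Box {} (?c \<^bold>\<longrightarrow> \<phi>)) ?D \<tturnstile> Box {} (?c \<^bold>\<longrightarrow> \<phi>)"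
      by (rule entails_hyp) simp_all
    ultimately have "insert (Box {} (?c \<^bold>\<longrightarrow> \<phi>)) ?D \<tturnstile> Box {} (\<^bold>\<not> state_fm s')"
      by (rule entails_Box_MP)
    then have "?D \<tturnstile> Box {} (?c \<^bold>\<longrightarrow> \<phi>) \<^bold>\<longrightarrow> Box {} (\<^bold>\<not> state_fm s')"
      by (intro deduction) auto
    then have "insert (state_fm s) ?D \<tturnstile> Box {} (?c \<^bold>\<longrightarrow> \<phi>) \<^bold>\<longrightarrow> Box {} (\<^bold>\<not> state_fm s')"
      using entails_mono by blast
    \<comment> \<open>\<open>Comp\<close> makes the state \<open>s'\<close> possible, which
      contradicts the boxed negation of its formula.\<close>
    with iff have "insert (state_fm s) ?D \<tturnstile> \<^bold>\<not> Box X \<phi>"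
      using X s'(1) provable_Comp[OF s'(1)]
      by - (rule entails_consequence[of "{Box X \<phi> \<^bold>\<longleftrightarrow> Box {} (?c \<^bold>\<longrightarrow> \<phi>),
        Box {} (?c \<^bold>\<longrightarrow> \<phi>) \<^bold>\<longrightarrow> Box {} (\<^bold>\<not> state_fm s'), Dia {} (state_fm s')}"],
        auto intro: entails_provable)
    with False show ?thesis by (simp del: sat.simps)
  qed
next
  case (Assign x \<phi> \<psi>)
  then show ?case by simp
qed

section \<open>Exhaustiveness of the descriptions and completeness without assignments\<close>

text \<open>If every disjunct failed, \<open>provable_Five\<close> would box each failure. By
  \<open>T\<close>, \<open>Funct\<close> and \<open>AtLeast\<close> these boxed failures refute the
  formula for \<open>Y\<close>; boxing the refutation contradicts \<open>Comp\<close>.\<close>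

lemma provable_some_decision:
  assumes Y: "Y \<in> States"
  shows "\<turnstile> BigDis ((\<lambda>x. Box {} (state_fm Y \<^bold>\<longrightarrow> Atom (t x))) ` Val)"
proof -
  let ?\<beta> = "\<lambda>x. Box {} (state_fm Y \<^bold>\<longrightarrow> Atom (t x))"
  let ?\<Gamma> = "(\<lambda>x. Box {} (\<^bold>\<not> ?\<beta> x)) ` Val"
  let ?T = "(\<lambda>x. Box {} (\<^bold>\<not> ?\<beta> x) \<^bold>\<longrightarrow> \<^bold>\<not> ?\<beta> x) ` Val"
  let ?F = "(\<lambda>x. (state_fm Y \<^bold>\<and> Atom (t x)) \<^bold>\<longrightarrow> ?\<beta> x) ` Val"
  let ?F5 = "(\<lambda>x. \<^bold>\<not> ?\<beta> x \<^bold>\<longrightarrow> Box {} (\<^bold>\<not> ?\<beta> x)) ` Val"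
  have "?\<Gamma> \<tturnstile> \<^bold>\<not> state_fm Y"
  proof (rule entails_consequence[of "insert (BigDis ((\<lambda>x. Atom (t x)) ` Val)) (?T \<union> ?F)"])
    show "?\<Gamma> \<tturnstile> \<alpha>" if "\<alpha> \<in> insert (BigDis ((\<lambda>x. Atom (t x)) ` Val)) (?T \<union> ?F)" for \<alpha>
      using that AtLeast T provable_Funct Y by (intro entails_provable) auto
  qed (use finite_Val Y in \<open>auto simp: ball_Un\<close>)
  then have "?\<Gamma> \<tturnstile> Box {} (\<^bold>\<not> state_fm Y)"
    using finite_Val Y by (intro entails_Box) auto
  then have *: "?\<Gamma> \<tturnstile> \<^bold>\<not> Dia {} (state_fm Y)"
    using Y by - (rule entails_consequence[of "{Box {} (\<^bold>\<not> state_fm Y)}"], auto)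
  obtain \<Theta> where \<Theta>: "finite \<Theta>" "\<And>\<theta>. \<theta> \<in> \<Theta> \<Longrightarrow> \<turnstile> \<theta>"
    "\<And>v. \<forall>\<gamma>\<in>?\<Gamma>. truth_value v \<gamma> \<Longrightarrow> \<forall>\<theta>\<in>\<Theta>. truth_value v \<theta> \<Longrightarrow>
      truth_value v (\<^bold>\<not> Dia {} (state_fm Y))"
    using * by (rule entailsE) (rule that)
  show ?thesis
  proof (rule provable_if_consequence[of "insert (Dia {} (state_fm Y)) (\<Theta> \<union> ?F5)"])
    show "\<turnstile> \<theta>" if "\<theta> \<in> insert (Dia {} (state_fm Y)) (\<Theta> \<union> ?F5)" for \<theta>
      using that \<Theta>(2) provable_Comp[OF Y] Y by (auto intro!: provable_Five)
  next
    fix v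
    assume v: "\<forall>\<theta> \<in> insert (Dia {} (state_fm Y)) (\<Theta> \<union> ?F5). truth_value v \<theta>"
    show "truth_value v (BigDis (?\<beta> ` Val))"
    proof (rule ccontr)
      assume "\<not> truth_value v (BigDis (?\<beta> ` Val))"
      \<comment> \<open>The instances of negative introspection in \<open>?F5\<close> turn each
        false disjunct into a true hypothesis of \<open>?\<Gamma>\<close>.\<close>
      then have "\<forall>\<gamma>\<in>?\<Gamma>. truth_value v \<gamma>" "\<forall>\<theta>\<in>\<Theta>. truth_value v \<theta>"
        using v finite_Val by (simp_all add: ball_Un)
      from \<Theta>(3)[OF this] v show False by simp
    qed
  qed (use \<Theta>(1) finite_Val Y in auto)
qed

text \<open>Hypotheses are discharged state by state: if every value at \<open>Y\<close> leads to
  \<open>\<phi>\<close>, then the provable disjunction over the values at \<open>Y\<close> removes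
  \<open>Y\<close> from the description.\<close>

lemma provable_cases_description:
  assumes "finite A" "A \<subseteq> States" "\<phi> \<in> lang"
    and "\<And>f. f ` A \<subseteq> Val \<Longrightarrow> description A f \<tturnstile> \<phi>"
  shows "\<turnstile> \<phi>"
  using assms(1,2,4)
proof (induction A rule: finite_induct)
  case empty
  then show ?case by (simp add: description_def provable_iff_entails)
next
  case (insert Y A)
  let ?\<beta> = "\<lambda>x. Box {} (state_fm Y \<^bold>\<longrightarrow> Atom (t x))"
  show ?case
  proof (rule insert.IH)
    fix f :: "'a set \<Rightarrow> 'v" assume f: "f ` A \<subseteq> Val"
    have Y: "Y \<in> States" using insert.prems by blast
    have "insert (?\<beta> x) (description A f) \<tturnstile> \<phi>" if x: "x \<in> Val" for x
    proof -
      \<comment> \<open>As \<open>Y\<close> is not in \<open>A\<close>, changing the function at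
        \<open>Y\<close> leaves the description on \<open>A\<close> untouched.\<close>
      have "description (insert Y A) (f(Y := x)) = insert (?\<beta> x) (description A f)"
        using insert.hyps by (auto simp: description_def)
      moreover have "f(Y := x) ` insert Y A \<subseteq> Val"
        using f x by auto
      ultimately show ?thesis
        using insert.prems(2)[of "f(Y := x)"] by (simp del: fun_upd_apply)
    qed
    then have "description A f \<tturnstile> ?\<beta> x \<^bold>\<longrightarrow> \<phi>" if "x \<in> Val" for x
      using that Y by (intro deduction) auto
    then show "description A f \<tturnstile> \<phi>"
      using finite_Val assms(3) entails_provable[OF provable_some_decision[OF Y]]
      by - (rule entails_consequence[of "insert (BigDis (?\<beta> ` Val)) ((\<lambda>x. ?\<beta> x \<^bold>\<longrightarrow> \<phi>) ` Val)"],
        auto)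
  qed (use insert.prems in auto)
qed

text \<open>Each description with a state formula decides \<open>\<phi>\<close> according to its
  truth there, and validity leaves only the positive answer. Both case distinctions then discharge
  the hypotheses.\<close>

lemma complete_assignment_free:
  assumes "assignment_free \<phi>" "\<phi> \<in> lang" "valid \<phi>"
  shows "\<turnstile> \<phi>"
proof (rule provable_cases_description[OF finite_States])
  fix f assume f: "f ` States \<subseteq> Val"
  show "description States f \<tturnstile> \<phi>"
  proof (rule entails_cases_state)
    fix s assume s: "s \<in> States"
    then have "sat States f s \<phi>"
      using assms(3) f by (auto simp: valid_def classifier_model_def)
    then show "insert (state_fm s) (description States f) \<tturnstile> \<phi>"
      using description_decides[OF assms(1,2) f s] by simp
  qed (rule assms(2))
qed (use assms(2) in auto)


subsection \<open>Eliminating assignments\<close>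

lemma provable_Iff_refl: "\<phi> \<in> lang \<Longrightarrow> \<turnstile> \<phi> \<^bold>\<longleftrightarrow> \<phi>"
  by (intro Taut) (auto simp: tautology_def)

lemma provable_Iff_trans:
  assumes "\<turnstile> \<phi> \<^bold>\<longleftrightarrow> \<psi>" "\<turnstile> \<psi> \<^bold>\<longleftrightarrow> \<chi>"
  shows "\<turnstile> \<phi> \<^bold>\<longleftrightarrow> \<chi>"
  by (rule provable_if_consequence[of "{\<phi> \<^bold>\<longleftrightarrow> \<psi>, \<psi> \<^bold>\<longleftrightarrow> \<chi>}"])
    (use assms assms[THEN provable_in_lang] in auto)

lemma provable_Neg_cong:
  assumes "\<turnstile> \<phi> \<^bold>\<longleftrightarrow> \<psi>"
  shows "\<turnstile> \<^bold>\<not> \<phi> \<^bold>\<longleftrightarrow> \<^bold>\<not> \<psi>"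
  by (rule provable_if_consequence[of "{\<phi> \<^bold>\<longleftrightarrow> \<psi>}"])
    (use assms provable_in_lang[OF assms] in auto)

lemma provable_Con_cong:
  assumes "\<turnstile> \<phi> \<^bold>\<longleftrightarrow> \<psi>" "\<turnstile> \<phi>' \<^bold>\<longleftrightarrow> \<psi>'"
  shows "\<turnstile> (\<phi> \<^bold>\<and> \<phi>') \<^bold>\<longleftrightarrow> (\<psi> \<^bold>\<and> \<psi>')"
  by (rule provable_if_consequence[of "{\<phi> \<^bold>\<longleftrightarrow> \<psi>, \<phi>' \<^bold>\<longleftrightarrow> \<psi>'}"])
    (use assms assms[THEN provable_in_lang] in auto)

lemma provable_Box_cong:
  assumes "\<turnstile> \<phi> \<^bold>\<longleftrightarrow> \<psi>" "X \<subseteq> Idx"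
  shows "\<turnstile> Box X \<phi> \<^bold>\<longleftrightarrow> Box X \<psi>"
  using assms(2) provable_in_lang[OF assms(1)]
  by (intro RE[OF assms(1)]) (auto intro: replaces.intros)

text \<open>Replacement handles one pair of equivalents at a time, so condition and scope are
  exchanged in two steps; \<open>keep\<close> protects the other argument.\<close>

lemma provable_Assign_cong:
  assumes "\<turnstile> \<phi> \<^bold>\<longleftrightarrow> \<phi>'" "\<turnstile> \<psi> \<^bold>\<longleftrightarrow> \<psi>'" "x \<in> Val"
  shows "\<turnstile> Assign x \<phi> \<psi> \<^bold>\<longleftrightarrow> Assign x \<phi>' \<psi>'"
proof (rule provable_Iff_trans)
  note [simp] = assms(1,2)[THEN provable_in_lang, unfolded lang_simps]
  show "\<turnstile> Assign x \<phi> \<psi> \<^bold>\<longleftrightarrow> Assign x \<phi>' \<psi>"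
    by (rule RE[OF assms(1)]) (use assms(3) in \<open>auto intro: replaces.intros\<close>)
  show "\<turnstile> Assign x \<phi>' \<psi> \<^bold>\<longleftrightarrow> Assign x \<phi>' \<psi>'"
    by (rule RE[OF assms(2)]) (use assms(3) in \<open>auto intro: replaces.intros\<close>)
qed

text \<open>The reduction axioms push the assignment through \<open>\<psi>\<close> to its atoms,
  where it disappears. The congruences apply the induction hypothesis beneath the connective just
  crossed.\<close>

lemma Assign_assignment_free:
  assumes "assignment_free \<psi>" "\<psi> \<in> lang" "assignment_free \<phi>" "\<phi> \<in> lang" "x \<in> Val"
  shows "\<exists>\<chi>. assignment_free \<chi> \<and> \<turnstile> Assign x \<phi> \<psi> \<^bold>\<longleftrightarrow> \<chi>"
  using assms(1,2)
proof (induction \<psi>)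
  case (Atom p)
  consider "p = t x" | y where "y \<in> Val" "y \<noteq> x" "p = t y" | "p \<in> Atm - Dec"
    using Atom.prems by (auto simp: Dec_def)
  then show ?case
  proof cases
    case 1
    then show ?thesis
      using AssignSame[of x \<phi>] assms by (intro exI[of _ "\<phi> \<^bold>\<or> Atom (t x)"]) simp
  next
    case (2 y)
    then show ?thesis
      using AssignOther[of x y \<phi>] assms by (intro exI[of _ "\<^bold>\<not> \<phi> \<^bold>\<and> Atom (t y)"]) simp
  next
    case 3
    then show ?thesis
      using AssignAtom[of x \<phi> p] assms by (intro exI[of _ "Atom p"]) simp
  qed
next
  case (Neg \<psi>)
  then obtain \<chi> where "assignment_free \<chi>" "\<turnstile> Assign x \<phi> \<psi> \<^bold>\<longleftrightarrow> \<chi>" by auto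
  then show ?case
    using provable_Iff_trans[OF AssignNeg provable_Neg_cong] assms Neg.prems
    by (intro exI[of _ "\<^bold>\<not> \<chi>"]) simp
next
  case (Con \<psi>\<^sub>1 \<psi>\<^sub>2)
  then obtain \<chi>\<^sub>1 \<chi>\<^sub>2 where "assignment_free \<chi>\<^sub>1" "\<turnstile> Assign x \<phi> \<psi>\<^sub>1 \<^bold>\<longleftrightarrow> \<chi>\<^sub>1"
    "assignment_free \<chi>\<^sub>2" "\<turnstile> Assign x \<phi> \<psi>\<^sub>2 \<^bold>\<longleftrightarrow> \<chi>\<^sub>2" by auto
  then show ?case
    using provable_Iff_trans[OF AssignCon provable_Con_cong] assms Con.prems
    by (intro exI[of _ "\<chi>\<^sub>1 \<^bold>\<and> \<chi>\<^sub>2"]) simp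
next
  case (Box X \<psi>)
  then obtain \<chi> where "assignment_free \<chi>" "\<turnstile> Assign x \<phi> \<psi> \<^bold>\<longleftrightarrow> \<chi>" by auto
  then show ?case
    using provable_Iff_trans[OF AssignBox provable_Box_cong] assms Box.prems
    by (intro exI[of _ "Box X \<chi>"]) simp
next
  case (Assign y \<psi>\<^sub>1 \<psi>\<^sub>2)
  then show ?case by simp
qed

lemma equivalent_assignment_free:
  assumes "\<phi> \<in> lang"
  shows "\<exists>\<chi>. assignment_free \<chi> \<and> \<turnstile> \<phi> \<^bold>\<longleftrightarrow> \<chi>"
  using assms
proof (induction \<phi>)
  case (Atom p)
  then show ?case
    using provable_Iff_refl by (intro exI[of _ "Atom p"]) simp
next
  case (Neg \<phi>)
  then obtain \<chi> where "assignment_free \<chi>" "\<turnstile> \<phi> \<^bold>\<longleftrightarrow> \<chi>" by auto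
  then show ?case
    using provable_Neg_cong by (intro exI[of _ "\<^bold>\<not> \<chi>"]) simp
next
  case (Con \<phi> \<psi>)
  then obtain \<chi> \<chi>' where "assignment_free \<chi>" "\<turnstile> \<phi> \<^bold>\<longleftrightarrow> \<chi>" "assignment_free \<chi>'" "\<turnstile> \<psi> \<^bold>\<longleftrightarrow> \<chi>'"
    by auto
  then show ?case
    using provable_Con_cong by (intro exI[of _ "\<chi> \<^bold>\<and> \<chi>'"]) simp
next
  case (Box X \<phi>)
  then obtain \<chi> where "assignment_free \<chi>" "\<turnstile> \<phi> \<^bold>\<longleftrightarrow> \<chi>" by auto
  then show ?case
    using provable_Box_cong Box.prems by (intro exI[of _ "Box X \<chi>"]) simp
next
  case (Assign x \<phi> \<psi>)
  then obtain \<chi> \<chi>' where \<chi>: "assignment_free \<chi>" "\<turnstile> \<phi> \<^bold>\<longleftrightarrow> \<chi>"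
    and \<chi>': "assignment_free \<chi>'" "\<turnstile> \<psi> \<^bold>\<longleftrightarrow> \<chi>'"
    by auto
  \<comment> \<open>Condition and scope are already assignment-free by induction, so a single outer
    assignment remains to be pushed inwards.\<close>
  then obtain \<chi>'' where "assignment_free \<chi>''" "\<turnstile> Assign x \<chi> \<chi>' \<^bold>\<longleftrightarrow> \<chi>''"
    using Assign_assignment_free[of \<chi>' \<chi> x] \<chi>(2)[THEN provable_in_lang]
      \<chi>'(2)[THEN provable_in_lang] Assign.prems by auto
  then show ?case
    using provable_Iff_trans[OF provable_Assign_cong[OF \<chi>(2) \<chi>'(2)]] Assign.prems by auto
qed

section \<open>Soundness and completeness for the full language\<close>

lemma sound_complete:
  assumes "\<phi> \<in> lang"
  shows "\<turnstile> \<phi> \<longleftrightarrow> valid \<phi>"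
proof
  assume "\<turnstile> \<phi>"
  then show "valid \<phi>"
    using sound by (auto simp: valid_def classifier_model_def)
next
  assume "valid \<phi>"
  obtain \<chi> where \<chi>: "assignment_free \<chi>" "\<turnstile> \<phi> \<^bold>\<longleftrightarrow> \<chi>"
    using equivalent_assignment_free[OF assms] by blast
  have "\<chi> \<in> lang"
    using provable_in_lang[OF \<chi>(2)] by simp
  \<comment> \<open>Soundness of the provable equivalence transfers validity from
    \<open>\<phi>\<close> to its assignment-free form.\<close>
  moreover have "valid \<chi>"
    using \<open>valid \<phi>\<close> sound[OF \<chi>(2)] by (auto simp: valid_def classifier_model_def)
  ultimately have "\<turnstile> \<chi>"
    using \<chi>(1) complete_assignment_free by blast
  then show "\<turnstile> \<phi>"
    using \<chi>(2) assms by - (rule provable_if_consequence[of "{\<chi>, \<phi> \<^bold>\<longleftrightarrow> \<chi>}"], auto)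
qed

end

theorem theorem3:
  fixes Atm :: "'a set" and Val :: "'v set" and t :: "'v \<Rightarrow> 'a" and Idx :: "'a set"
  assumes "finite Atm" and "finite Val"
    and "inj_on t Val" and "t ` Val \<subseteq> Atm"
    and "Idx = Atm \<or> Idx = Atm - t ` Val"
  shows "\<forall>\<phi> \<in> classifier_logic.lang Atm Val Idx.
    classifier_logic.bcl_dc Atm Val t Idx \<phi> \<longleftrightarrow> classifier_logic.valid Atm Val t \<phi>"
proof (cases "Atm = {}")
  case True
  \<comment> \<open>Every formula contains an atom, so without atoms the language is empty and the
    claim is vacuous.\<close>
  have "\<not> classifier_logic.in_lang {} Val Idx \<phi>" for \<phi> :: "('a, 'v) fm"
    by (induction \<phi>) (auto simp: classifier_logic.in_lang.simps)
  with True show ?thesis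
    by (simp add: classifier_logic.lang_def)
next
  case False
  then interpret finite_classifier_logic Atm Val t Idx
    by unfold_locales (use assms in auto)
  show ?thesis
    using sound_complete by blast
qed

end
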